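(* Let $X \subseteq \mathbb{Z}^{p_1}\times\mathbb{R}^{n_1-p_1}$ be nonempty, let $N\ge 1$, let $f_1,\dots,f_N: X\to\mathbb{R}$ be arbitrary functions, and let $v^* := \min_{\bm{x}\in X}\sum_{i=1}^N f_i(\bm{x})$. Then: (1) (Weak duality) For any functions $g_i: X\to\mathbb{R}$, $i\in[N]$, such that $\sum_{i=1}^N g_i(\bm{x})=0$ for all $\bm{x}\in X$, $$\sum_{i=1}^N \min_{\bm{x}^i\in X}\{f_i(\bm{x}^i)+g_i(\bm{x}^i)\}\ \le\ v^*.$$ (2) (Strong duality) $v_{\mathrm{GDD}} = v^*$, where $$v_{\mathrm{GDD}} := \max\Big\{\sum_{i=1}^N \min_{\bm{x}^i\in X}\{f_i(\bm{x}^i)+g_i(\bm{x}^i)\}\ :\ g_i: X\to\mathbb{R}\ \ \forall i\in[N],\ \ \sum_{i=1}^N g_i(\bm{x})=0\ \ \forall \bm{x}\in X\Big\}.$$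
   Context: $[N]:=\{1,\dots,N\}$. The value $v^*$ is the optimal value of a two-stage stochastic program in which $f_i$ is the recourse function of scenario $i$; no structure is imposed on the $f_i$. All minima are read as infima, with values in $[-\infty,\infty)$. *)

theory Defs
  imports "HOL-Library.Extended_Real" "HOL-Library.FuncSet"
begin

text \<open>
  A point of \<open>\<int>\<^sup>p \<times> \<real>\<^sup>n\<^sup>-\<^sup>p\<close> is an extensional function on the coordinate set \<open>{..<n}\<close> (intended for
  \<open>p \<le> n\<close>).  Coordinate sets rather than index types are used so that \<open>n\<close> is an ordinary
  natural number and the cases \<open>p = 0\<close>, \<open>p = n\<close> are included.
\<close>

definition mixed_integer_space :: "nat \<Rightarrow> nat \<Rightarrow> (nat \<Rightarrow> real) set" where
  "mixed_integer_space p n = (\<Pi>\<^sub>E i\<in>{..<n}. if i < p then \<int> else UNIV)"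

text \<open>
  Functions on \<open>X\<close> are represented by total functions; every definition below evaluates them on
  \<open>X\<close> only.  Minima are infima in \<^typ>\<open>ereal\<close>.  For nonempty \<open>X\<close> no such infimum is \<open>\<infinity>\<close>, so
  sums of infima never involve \<open>\<infinity> + (-\<infinity>)\<close>, and a sum is \<open>-\<infinity>\<close> as soon as one summand is.
\<close>

definition opt_value :: "'a set \<Rightarrow> nat \<Rightarrow> (nat \<Rightarrow> 'a \<Rightarrow> real) \<Rightarrow> ereal" where
  "opt_value X N f = (INF x\<in>X. ereal (\<Sum>i=1..N. f i x))"

definition gdd_feasible :: "'a set \<Rightarrow> nat \<Rightarrow> (nat \<Rightarrow> 'a \<Rightarrow> real) \<Rightarrow> bool" where
  "gdd_feasible X N g \<longleftrightarrow> (\<forall>x\<in>X. (\<Sum>i=1..N. g i x) = 0)"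

definition gdd_bound ::
  "'a set \<Rightarrow> nat \<Rightarrow> (nat \<Rightarrow> 'a \<Rightarrow> real) \<Rightarrow> (nat \<Rightarrow> 'a \<Rightarrow> real) \<Rightarrow> ereal" where
  "gdd_bound X N f g = (\<Sum>i=1..N. INF x\<in>X. ereal (f i x + g i x))"

text \<open>
  The dual value as a supremum; that it is a maximum, i.e. attained, is a separate assertion.
\<close>

definition v_GDD :: "'a set \<Rightarrow> nat \<Rightarrow> (nat \<Rightarrow> 'a \<Rightarrow> real) \<Rightarrow> ereal" where
  "v_GDD X N f = (SUP g\<in>{g. gdd_feasible X N g}. gdd_bound X N f g)"

end

(* Equality is attained by the multipliers that move the whole objective into scenario 1: taking
   g 1 = (f 1 + ... + f N) - f 1 and g i = - f i otherwise, the first subproblem is the original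
   problem and all others are identically zero. *)
theory Submission
  imports Defs
begin

text \<open>Evaluating every subproblem at one common \<open>x\<close> bounds each infimum from
  above, and there the terms \<open>g i x\<close> cancel in the sum.\<close>

lemma gdd_bound_le_opt_value:
  assumes "gdd_feasible X N g"
  shows "gdd_bound X N f g \<le> opt_value X N f"
  unfolding opt_value_def
proof (rule INF_greatest)
  fix x assume x: "x \<in> X"
  have "gdd_bound X N f g \<le> (\<Sum>i=1..N. ereal (f i x + g i x))"
    unfolding gdd_bound_def by (intro sum_mono INF_lower x)
  also have "\<dots> = ereal (\<Sum>i=1..N. f i x)"
    using assms x by (simp add: gdd_feasible_def sum.distrib)
  finally show "gdd_bound X N f g \<le> ereal (\<Sum>i=1..N. f i x)" .
qed

lemma gdd_bound_attains_opt_value: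
  assumes "X \<noteq> {}" and "N \<ge> 1"
  obtains g where "gdd_feasible X N g" "gdd_bound X N f g = opt_value X N f"
proof
  define g where "g i x = (if i = 1 then \<Sum>j=1..N. f j x else 0) - f i x" for i x
  show "gdd_feasible X N g"
    \<comment> \<open>\<open>N \<ge> 1\<close> puts index 1 in range, so the full objective is
      counted exactly once.\<close>
    using \<open>N \<ge> 1\<close> by (simp add: gdd_feasible_def g_def sum_subtractf)
  \<comment> \<open>For \<open>i \<noteq> 1\<close> this is the infimum of the constant 0, which is
    0 because \<open>X\<close> is nonempty; over the empty set it would be \<infinity>.\<close>
  have "(INF x\<in>X. ereal (f i x + g i x)) = (if i = 1 then opt_value X N f else 0)" for i
    using \<open>X \<noteq> {}\<close> by (simp add: g_def opt_value_def flip: zero_ereal_def)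
  then show "gdd_bound X N f g = opt_value X N f"
    using \<open>N \<ge> 1\<close> by (simp add: gdd_bound_def)
qed

theorem theorem1:
  fixes p1 n1 N :: nat
    and X :: "(nat \<Rightarrow> real) set"
    and f :: "nat \<Rightarrow> (nat \<Rightarrow> real) \<Rightarrow> real"
  assumes "p1 \<le> n1"
    and "X \<subseteq> mixed_integer_space p1 n1"
    and "X \<noteq> {}"
    and "N \<ge> 1"
  shows "(\<forall>g. gdd_feasible X N g \<longrightarrow> gdd_bound X N f g \<le> opt_value X N f)
    \<and> v_GDD X N f = opt_value X N f
    \<and> (\<exists>g. gdd_feasible X N g \<and> gdd_bound X N f g = v_GDD X N f)"
proof -
  obtain g where g: "gdd_feasible X N g" "gdd_bound X N f g = opt_value X N f"
    using gdd_bound_attains_opt_value assms(3,4) .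
  have "v_GDD X N f = opt_value X N f"
    unfolding v_GDD_def
  proof (rule antisym)
    show "(SUP g\<in>{g. gdd_feasible X N g}. gdd_bound X N f g) \<le> opt_value X N f"
      by (auto intro: SUP_least gdd_bound_le_opt_value)
    show "opt_value X N f \<le> (SUP g\<in>{g. gdd_feasible X N g}. gdd_bound X N f g)"
      using g by (metis SUP_upper mem_Collect_eq)
  qed
  \<comment> \<open>The same \<open>g\<close> shows that the supremum is attained, even when the
    common value is -\<infinity>.\<close>
  with g show ?thesis
    using gdd_bound_le_opt_value by metis
qed

end
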